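(* Let $x=[0;a_1,a_2,\dots,a_n,a_{n+1},a_{n+2},\dots]$ be a real number in $[0,1)$ given by its regular continued fraction expansion, where $n\ge 2$ and $(a_n,a_{n+1})=(1,1)$, and put $m=\min\{a_{n-1},a_{n+2}\}$ and $M=\max\{a_{n-1},a_{n+2}\}$. (i) If $1\le m=M$, then $$\min\{\Theta_{n-1}(x),\Theta_n(x)\}\le \frac{(m+1)(m+2)}{(m+1)^2+(m+2)^2}<\frac12$$ and $$\max\{\Theta_{n-1}(x),\Theta_n(x)\}> \frac{m(m+1)}{m^2+(m+1)^2}\ge\frac25.$$ (ii) If $1\le m<M$, then $$\min\{\Theta_{n-1}(x),\Theta_n(x)\}< \frac{(m+1)(M+1)}{(m+1)M+(m+2)(M+1)}$$ and $$\max\{\Theta_{n-1}(x),\Theta_n(x)\}> \frac{(m+2)M}{(m+1)M+(m+2)(M+1)}.$$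
   Context: The regular continued fraction (RCF) expansion of $x\in[0,1)$ is $x=[0;a_1,a_2,\dots]=\cfrac{1}{a_1+\cfrac{1}{a_2+\cdots}}$ with partial quotients $a_i$ positive integers. It is finite if and only if $x$ is rational (in that case $x$ has two RCF expansions); otherwise it is infinite and unique. The RCF convergents of $x$ are $p_k/q_k=[0;a_1,\dots,a_k]$, in lowest terms with $q_k>0$. The approximation coefficients of $x$ are $$\Theta_k(x)=q_k^2\left|x-\frac{p_k}{q_k}\right|,\qquad k\ge 1.$$
   Formalization: The strict bounds on Θ exclude the finite expansions where equality holds: [0;m,1,1,m] with n=2 for the max bound in (i) (e.g. x=3/5), and [0;M,1,1,m,1] with n=2 and [0;1,m,1,1,M] with n=3 for both bounds in (ii). *)

theory Defs
  imports Complex_Main "HOL-Library.Extended_Nat"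
begin

text \<open>The value of the finite continued fraction \<open>[0; d\<^sub>1, \<dots>, d\<^sub>k]\<close>.\<close>

fun cf_value :: "nat list \<Rightarrow> rat" where
  "cf_value [] = 0"
| "cf_value (d # ds) = 1 / (of_nat d + cf_value ds)"

text \<open>
  Digits are indexed from 1, so \<open>a 0\<close> is never used. An expansion of length \<open>N\<close> (possibly
  infinite) consists of the digits \<open>a i\<close> with \<open>1 \<le> i \<le> N\<close>; the other values of \<open>a\<close> are junk.
\<close>

definition rcf_convergent :: "(nat \<Rightarrow> nat) \<Rightarrow> nat \<Rightarrow> rat" where
  "rcf_convergent a k = cf_value (map a [1..<Suc k])"

text \<open>
  A rational number has two expansions in this sense, one of them with last digit 1.
\<close>

definition rcf_expansion :: "real \<Rightarrow> (nat \<Rightarrow> nat) \<Rightarrow> enat \<Rightarrow> bool" where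
  "rcf_expansion x a N \<longleftrightarrow>
     (\<forall>i\<ge>1. enat i \<le> N \<longrightarrow> a i \<ge> 1) \<and>
     (case N of
        enat k \<Rightarrow> x = of_rat (rcf_convergent a k)
      | \<infinity> \<Rightarrow> (\<lambda>k. of_rat (rcf_convergent a k)) \<longlonglongrightarrow> x)"

text \<open>
  \<open>q\<^sub>k\<^sup>2 \<bar>x - p\<^sub>k/q\<^sub>k\<bar>\<close>, where \<open>p\<^sub>k/q\<^sub>k\<close> is the \<open>k\<close>-th convergent in lowest terms with
  positive denominator, which is what \<^const>\<open>quotient_of\<close> returns.
\<close>

definition rcf_Theta :: "real \<Rightarrow> (nat \<Rightarrow> nat) \<Rightarrow> nat \<Rightarrow> real" where
  "rcf_Theta x a k =
     (let (p, q) = quotient_of (rcf_convergent a k)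
      in (of_int q)\<^sup>2 * \<bar>x - of_int p / of_int q\<bar>)"

text \<open>
  For certain finite expansions with \<open>a n = a (n + 1) = 1\<close> the bounds are attained, so that
  the strict inequalities turn into equalities. They are
  \<open>[0; m, 1, 1, m]\<close> with \<open>n = 2\<close> (for instance \<open>3/5 = [0; 1, 1, 1, 1]\<close>, whose first two
  approximation coefficients are both \<open>2/5\<close>), and, for \<open>m < M\<close>, \<open>[0; M, 1, 1, m, 1]\<close> with
  \<open>n = 2\<close> and \<open>[0; 1, m, 1, 1, M]\<close> with \<open>n = 3\<close>. Infinite expansions are never of this form.
\<close>

definition extremal_expansion :: "(nat \<Rightarrow> nat) \<Rightarrow> enat \<Rightarrow> nat \<Rightarrow> bool" where
  "extremal_expansion a N n \<longleftrightarrow>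
     (n = 2 \<and> N = enat 4 \<and> a 1 = a 4) \<or>
     (n = 2 \<and> N = enat 5 \<and> a 4 < a 1 \<and> a 5 = 1) \<or>
     (n = 3 \<and> N = enat 5 \<and> a 1 = 1 \<and> a 2 < a 5)"

lemma not_extremal_expansion_infinite: "\<not> extremal_expansion a \<infinity> n"
  by (simp add: extremal_expansion_def)

end

theory Submission
  imports Defs
begin

text \<open>
  With \<open>T = [0; a\<^sub>n\<^sub>+\<^sub>1, a\<^sub>n\<^sub>+\<^sub>2, \<dots>]\<close> and \<open>V = q\<^sub>n\<^sub>-\<^sub>1 / q\<^sub>n = [0; a\<^sub>n, \<dots>, a\<^sub>1]\<close> one has
  \<open>\<Theta>\<^sub>n\<^sub>-\<^sub>1 = V / (1 + T V)\<close> and \<open>\<Theta>\<^sub>n = T / (1 + T V)\<close>. If \<open>a\<^sub>n = a\<^sub>n\<^sub>+\<^sub>1 = 1\<close> then \<open>T = 1/A\<close> and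
  \<open>V = 1/B\<close> with \<open>A = 1 + 1/(a\<^sub>n\<^sub>+\<^sub>2 + u)\<close>, \<open>B = 1 + 1/(a\<^sub>n\<^sub>-\<^sub>1 + w)\<close> and \<open>u, w \<in> [0, 1]\<close>, so the
  coefficients become \<open>A / (A B + 1)\<close> and \<open>B / (A B + 1)\<close>, each increasing in the variable of its
  numerator and decreasing in the other one. The bounds are the values at corners of the range of
  \<open>(u, w)\<close>; the corners excluded by the strict inequalities are reached only by extremal expansions.
\<close>

subsection \<open>Tails of continued fraction expansions\<close>

lemma cf_value_bounds:
  assumes "\<forall>d\<in>set ds. d \<ge> 1"
  shows "0 \<le> cf_value ds \<and> cf_value ds \<le> 1"
  using assms
proof (induction ds)
  case (Cons d ds)
  then have "(1::rat) \<le> of_nat d" and "0 \<le> cf_value ds" by simp_all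
  then show ?case by simp
qed simp

lemma rcf_convergent_bounds:
  assumes "\<And>i. 1 \<le> i \<Longrightarrow> i \<le> k \<Longrightarrow> a i \<ge> 1"
  shows "0 \<le> rcf_convergent a k \<and> rcf_convergent a k \<le> 1"
  unfolding rcf_convergent_def by (rule cf_value_bounds) (use assms in auto)

lemma rcf_convergent_0: "rcf_convergent a 0 = 0"
  by (simp add: rcf_convergent_def)

lemma rcf_convergent_Suc:
  "rcf_convergent a (Suc k) = 1 / (of_nat (a 1) + rcf_convergent (\<lambda>i. a (Suc i)) k)"
proof -
  have "map a [1..<Suc (Suc k)] = a 1 # map (\<lambda>i. a (Suc i)) [1..<Suc k]"
    by (subst upt_conv_Cons) (simp_all add: map_Suc_upt[symmetric] comp_def del: upt_Suc map_Suc_upt)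
  then show ?thesis by (simp add: rcf_convergent_def del: upt_Suc)
qed

text \<open>Both ends occur: 0 for the empty expansion, 1 for \<open>[0; 1]\<close>. For infinite
  expansions the bounds on the convergents pass to the limit.\<close>

lemma rcf_expansion_bounds:
  assumes "rcf_expansion x a N"
  shows "0 \<le> x" and "x \<le> 1"
proof -
  have b: "0 \<le> (of_rat (rcf_convergent a k) :: real) \<and> (of_rat (rcf_convergent a k) :: real) \<le> 1"
    if "enat k \<le> N" for k
  proof -
    have "0 \<le> rcf_convergent a k \<and> rcf_convergent a k \<le> 1"
    proof (rule rcf_convergent_bounds)
      fix i assume "1 \<le> i" "i \<le> k"
      then have "enat i \<le> N" using that by (meson enat_ord_simps(1) order_trans)
      then show "a i \<ge> 1" using assms \<open>1 \<le> i\<close> by (auto simp: rcf_expansion_def)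
    qed
    then show ?thesis by simp
  qed
  have "0 \<le> x \<and> x \<le> 1"
  proof (cases N)
    case (enat k)
    then show ?thesis using assms b[of k] by (simp add: rcf_expansion_def)
  next
    case infinity
    then have "(\<lambda>k. of_rat (rcf_convergent a k)) \<longlonglongrightarrow> x"
      using assms by (simp add: rcf_expansion_def)
    then show ?thesis using b infinity
      by (auto intro: LIMSEQ_le_const LIMSEQ_le_const2)
  qed
  then show "0 \<le> x" and "x \<le> 1" by auto
qed

lemma rcf_expansion_0: "rcf_expansion x a 0 \<Longrightarrow> x = 0"
  by (simp add: rcf_expansion_def zero_enat_def rcf_convergent_0)

lemma rcf_expansion_digit_pos:
  "rcf_expansion x a N \<Longrightarrow> 1 \<le> i \<Longrightarrow> enat i \<le> N \<Longrightarrow> a i \<ge> 1"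
  by (simp add: rcf_expansion_def)

lemma one_le_eSuc: "enat (Suc 0) \<le> eSuc N"
  by (cases N) (simp_all add: eSuc_enat)

lemma enat_eSuc_cases:
  obtains "N = 0" | N' where "N = eSuc N'"
proof (cases N)
  case (enat k)
  then show thesis using that by (cases k) (auto simp: eSuc_enat[symmetric] zero_enat_def)
next
  case infinity
  then show thesis using that by (metis eSuc_infinity)
qed

text \<open>For finite expansions \<open>t\<close> is a convergent of the shifted digits. For
  infinite ones it is \<open>1 / x - a 1\<close>, the image of the limit under the map that sends
  the convergents of \<open>x\<close> to those of the tail.\<close>

lemma rcf_expansion_eSucE:
  assumes "rcf_expansion x a (eSuc N)"
  obtains t where "rcf_expansion t (\<lambda>i. a (Suc i)) N" and "x = 1 / (real (a 1) + t)"
proof -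
  let ?a = "\<lambda>i. a (Suc i)"
  have pos: "a i \<ge> 1" if "1 \<le> i" "enat i \<le> eSuc N" for i
    using assms that by (simp add: rcf_expansion_def)
  have pos': "\<forall>i\<ge>1. enat i \<le> N \<longrightarrow> ?a i \<ge> 1"
    using pos by (metis eSuc_enat eSuc_ile_mono le_SucI)
  have a1: "a 1 \<ge> 1" using pos[of 1] by (simp add: one_le_eSuc)
  show thesis
  proof (cases N)
    case (enat k)
    show thesis
    proof (rule that)
      show "rcf_expansion (of_rat (rcf_convergent ?a k)) ?a N"
        using pos' enat by (simp add: rcf_expansion_def)
      show "x = 1 / (real (a 1) + of_rat (rcf_convergent ?a k))"
        using assms enat
        by (simp add: rcf_expansion_def eSuc_enat rcf_convergent_Suc of_rat_divide of_rat_add)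
    qed
  next
    case infinity
    let ?r = "\<lambda>k. of_rat (rcf_convergent a (Suc k)) :: real"
    let ?c = "\<lambda>k. of_rat (rcf_convergent ?a k) :: real"
    have rc: "?r k = 1 / (real (a 1) + ?c k)" for k
      by (simp add: rcf_convergent_Suc of_rat_divide of_rat_add)
    have c: "0 \<le> ?c k \<and> ?c k \<le> 1" for k
      using rcf_convergent_bounds[of k ?a] pos' infinity by simp
    have "(\<lambda>k. of_rat (rcf_convergent a k)) \<longlonglongrightarrow> x"
      using assms infinity by (simp add: rcf_expansion_def)
    then have lim: "?r \<longlonglongrightarrow> x" by (rule LIMSEQ_Suc)
    \<comment> \<open>From index 1 on the convergents are bounded below by a positive constant, so
      the limit is nonzero and inversion is continuous there.\<close>
    have "1 / (real (a 1) + 1) \<le> ?r k" for k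
      unfolding rc using c[of k] a1 by (intro frac_le add_pos_nonneg) auto
    then have "1 / (real (a 1) + 1) \<le> x"
      using lim by (auto intro: LIMSEQ_le_const)
    moreover have "0 < 1 / (real (a 1) + 1)" by simp
    ultimately have "x \<noteq> 0" by linarith
    with lim have "(\<lambda>k. 1 / ?r k - real (a 1)) \<longlonglongrightarrow> 1 / x - real (a 1)"
      by (intro tendsto_intros)
    moreover have "1 / ?r k - real (a 1) = ?c k" for k
      using c[of k] a1 by (simp add: rc)
    ultimately have "?c \<longlonglongrightarrow> 1 / x - real (a 1)" by simp
    then have "rcf_expansion (1 / x - real (a 1)) ?a N"
      using pos' infinity by (simp add: rcf_expansion_def)
    then show thesis by (rule that) (use \<open>x \<noteq> 0\<close> in simp)
  qed
qed

text \<open>A nonempty expansion has value \<open>1 / (a 1 + t)\<close> with a positive denominator.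
  Hence a tail equal to 0 means that the digits have ended.\<close>

lemma rcf_expansion_eq_0:
  assumes "rcf_expansion 0 a N"
  shows "N = 0"
proof (rule ccontr)
  assume "N \<noteq> 0"
  then obtain N' where N: "N = eSuc N'" by (cases N rule: enat_eSuc_cases) auto
  with assms obtain t where t: "rcf_expansion t (\<lambda>i. a (Suc i)) N'" "0 = 1 / (real (a 1) + t)"
    by (blast elim: rcf_expansion_eSucE)
  have "a 1 \<ge> 1"
    by (rule rcf_expansion_digit_pos[OF assms]) (simp_all add: N one_le_eSuc)
  then show False using t(2) rcf_expansion_bounds(1)[OF t(1)] by simp
qed

text \<open>As \<open>a 1 \<ge> 1\<close> and \<open>t \<ge> 0\<close>, the equation
  \<open>a 1 + t = 1\<close> forces \<open>t = 0\<close>, and then nothing follows the first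
  digit.\<close>

lemma rcf_expansion_eq_1:
  assumes "rcf_expansion 1 a N"
  shows "N = 1" and "a 1 = 1"
proof -
  have "N \<noteq> 0" using assms rcf_expansion_0 by fastforce
  then obtain N' where N: "N = eSuc N'" by (cases N rule: enat_eSuc_cases) auto
  with assms obtain t where t: "rcf_expansion t (\<lambda>i. a (Suc i)) N'" "1 = 1 / (real (a 1) + t)"
    by (blast elim: rcf_expansion_eSucE)
  have "a 1 \<ge> 1"
    by (rule rcf_expansion_digit_pos[OF assms]) (simp_all add: N one_le_eSuc)
  moreover have "real (a 1) + t = 1" using t(2) by (simp add: field_simps split: if_splits)
  ultimately have "a 1 = 1 \<and> t = 0" using rcf_expansion_bounds(1)[OF t(1)] by simp
  then show "a 1 = 1" "N = 1" using t(1) rcf_expansion_eq_0 N by (auto simp: one_eSuc)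
qed

subsection \<open>Continuants\<close>

text \<open>The indices are shifted by one: \<open>rcf_num a (k + 1)\<close> is \<open>p\<^sub>k\<close>, starting from \<open>p\<^sub>-\<^sub>1 = 1\<close>.\<close>

fun rcf_num :: "(nat \<Rightarrow> nat) \<Rightarrow> nat \<Rightarrow> int" where
  "rcf_num a 0 = 1"
| "rcf_num a (Suc 0) = 0"
| "rcf_num a (Suc (Suc k)) = int (a (Suc k)) * rcf_num a (Suc k) + rcf_num a k"

fun rcf_den :: "(nat \<Rightarrow> nat) \<Rightarrow> nat \<Rightarrow> int" where
  "rcf_den a 0 = 0"
| "rcf_den a (Suc 0) = 1"
| "rcf_den a (Suc (Suc k)) = int (a (Suc k)) * rcf_den a (Suc k) + rcf_den a k"

lemma rcf_den_nonneg: "0 \<le> rcf_den a k"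
  by (induction a k rule: rcf_den.induct) auto

lemma rcf_den_pos:
  assumes "\<And>i. 1 \<le> i \<Longrightarrow> i \<le> k \<Longrightarrow> a i \<ge> 1"
  shows "0 < rcf_den a (Suc k)"
  using assms
proof (induction k)
  case (Suc k)
  then have "0 < rcf_den a (Suc k)" and "a (Suc k) \<ge> 1" by auto
  then show ?case using rcf_den_nonneg[of a k] by (simp add: add_pos_nonneg)
qed simp

text \<open>Each step of the recurrence multiplies the matrix of consecutive numerators and
  denominators by one of determinant -1.\<close>

lemma rcf_det: "rcf_num a k * rcf_den a (Suc k) - rcf_num a (Suc k) * rcf_den a k = (-1) ^ k"
  by (induction k) (auto simp: algebra_simps)

lemma rcf_det_abs: "\<bar>rcf_num a k * rcf_den a (Suc k) - rcf_num a (Suc k) * rcf_den a k\<bar> = 1"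
  by (simp add: rcf_det)

lemma coprime_rcf_num_den: "coprime (rcf_num a (Suc k)) (rcf_den a (Suc k))"
proof (rule coprimeI)
  fix c assume "c dvd rcf_num a (Suc k)" "c dvd rcf_den a (Suc k)"
  then have "c dvd rcf_num a k * rcf_den a (Suc k) - rcf_num a (Suc k) * rcf_den a k"
    by (intro dvd_diff dvd_mult dvd_mult2)
  then have "c dvd \<bar>rcf_num a k * rcf_den a (Suc k) - rcf_num a (Suc k) * rcf_den a k\<bar>"
    by (simp only: dvd_abs_iff)
  then show "is_unit c" unfolding rcf_det_abs .
qed

text \<open>The digits act on the tail by a Moebius map,
  \<open>x = (p_k + t p_(k-1)) / (q_k + t q_(k-1))\<close>, kept here free of division. The
  induction moves one more digit out of the tail.\<close>

lemma rcf_expansion_tail: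
  assumes "rcf_expansion x a (enat k + N)"
  obtains t :: real where "rcf_expansion t (\<lambda>i. a (i + k)) N"
    and "x * (rcf_den a (Suc k) + t * rcf_den a k) = rcf_num a (Suc k) + t * rcf_num a k"
proof -
  have "\<exists>t::real. rcf_expansion t (\<lambda>i. a (i + k)) N \<and>
      x * (rcf_den a (Suc k) + t * rcf_den a k) = rcf_num a (Suc k) + t * rcf_num a k"
    using assms
  proof (induction k arbitrary: N)
    case 0
    then show ?case by (auto simp: zero_enat_def[symmetric])
  next
    case (Suc k)
    \<comment> \<open>The length is regrouped so that the tail after \<open>k\<close> digits still
      has a first digit to split off.\<close>
    then have "rcf_expansion x a (enat k + eSuc N)"
      by (simp add: eSuc_enat[symmetric] iadd_Suc iadd_Suc_right)
    from Suc.IH[OF this] obtain t :: real where t: "rcf_expansion t (\<lambda>i. a (i + k)) (eSuc N)"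
      "x * (rcf_den a (Suc k) + t * rcf_den a k) = rcf_num a (Suc k) + t * rcf_num a k"
      by blast
    from t(1) obtain t' where t': "rcf_expansion t' (\<lambda>i. a (Suc i + k)) N"
      "t = 1 / (real (a (1 + k)) + t')"
      by (elim rcf_expansion_eSucE)
    have "1 \<le> a (1 + k)"
      by (rule rcf_expansion_digit_pos[OF t(1)]) (simp_all add: one_le_eSuc)
    then have y: "real (a (Suc k)) + t' > 0"
      using rcf_expansion_bounds(1)[OF t'(1)] by simp
    let ?y = "real (a (Suc k)) + t'"
    have ty: "?y * t = 1" using t'(2) y by simp
    \<comment> \<open>After scaling by \<open>?y\<close>, the part \<open>a (Suc k)\<close> of
      \<open>?y\<close> completes the recurrence and \<open>t'\<close> is left as the new
      tail.\<close>
    have "x * (?y * rcf_den a (Suc k) + (?y * t) * rcf_den a k)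
        = ?y * rcf_num a (Suc k) + (?y * t) * rcf_num a k"
      using arg_cong[OF t(2), of "\<lambda>z. ?y * z"] by (simp add: algebra_simps)
    then have "x * (rcf_den a (Suc (Suc k)) + t' * rcf_den a (Suc k))
        = rcf_num a (Suc (Suc k)) + t' * rcf_num a (Suc k)"
      unfolding ty by (simp add: algebra_simps)
    then show ?case using t'(1) by auto
  qed
  then show thesis using that by blast
qed

section \<open>Convergents and approximation coefficients in terms of continuants\<close>

lemma quotient_of_rcf_convergent:
  assumes "\<And>i. 1 \<le> i \<Longrightarrow> i \<le> k \<Longrightarrow> a i \<ge> 1"
  shows "quotient_of (rcf_convergent a k) = (rcf_num a (Suc k), rcf_den a (Suc k))"
proof -
  let ?r = "rcf_convergent a k"
  have pos: "0 < rcf_den a (Suc k)" using assms by (rule rcf_den_pos)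
  \<comment> \<open>The convergent is itself an expansion whose tail after \<open>k\<close> digits
    is empty, so \<open>t = 0\<close> in the Moebius relation.\<close>
  have "rcf_expansion (of_rat ?r) a (enat k + 0)"
    using assms by (simp add: rcf_expansion_def)
  then obtain t :: real where t: "rcf_expansion t (\<lambda>i. a (i + k)) 0"
    "of_rat ?r * (rcf_den a (Suc k) + t * rcf_den a k) = rcf_num a (Suc k) + t * rcf_num a k"
    by (rule rcf_expansion_tail)
  then have "(of_rat ?r :: real) * rcf_den a (Suc k) = rcf_num a (Suc k)"
    using rcf_expansion_0[OF t(1)] by simp
  then have "(of_rat (?r * of_int (rcf_den a (Suc k))) :: real) = of_rat (of_int (rcf_num a (Suc k)))"
    by (simp add: of_rat_mult)
  then have "?r * of_int (rcf_den a (Suc k)) = of_int (rcf_num a (Suc k))"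
    by (simp only: of_rat_eq_iff)
  then have "?r = Fract (rcf_num a (Suc k)) (rcf_den a (Suc k))"
    using pos by (simp add: Fract_of_int_quotient field_simps)
  then show ?thesis
    using pos coprime_rcf_num_den[of a k] by (simp add: quotient_of_Fract normalize_stable)
qed

lemma rcf_Theta_eq:
  fixes x :: real
  assumes "\<And>i. 1 \<le> i \<Longrightarrow> i \<le> k \<Longrightarrow> a i \<ge> 1"
  shows "rcf_Theta x a k = rcf_den a (Suc k) * \<bar>x * rcf_den a (Suc k) - rcf_num a (Suc k)\<bar>"
proof -
  have pos: "0 < real_of_int (rcf_den a (Suc k))" using rcf_den_pos[OF assms] by simp
  then have "\<bar>x * rcf_den a (Suc k) - rcf_num a (Suc k)\<bar>
      = \<bar>rcf_den a (Suc k) * (x - rcf_num a (Suc k) / rcf_den a (Suc k))\<bar>"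
    by (simp add: right_diff_distrib mult.commute)
  also have "\<dots> = rcf_den a (Suc k) * \<bar>x - rcf_num a (Suc k) / rcf_den a (Suc k)\<bar>"
    using pos by (simp only: abs_mult)
  finally have "\<bar>x * rcf_den a (Suc k) - rcf_num a (Suc k)\<bar>
      = rcf_den a (Suc k) * \<bar>x - rcf_num a (Suc k) / rcf_den a (Suc k)\<bar>" .
  moreover have "quotient_of (rcf_convergent a k) = (rcf_num a (Suc k), rcf_den a (Suc k))"
    using assms by (rule quotient_of_rcf_convergent)
  ultimately show ?thesis by (simp add: rcf_Theta_def power2_eq_square)
qed

text \<open>\<open>t\<close> and \<open>v\<close> are the \<open>T\<close> and \<open>V\<close> of the introduction.\<close>

lemma rcf_Theta_pair:
  fixes x t :: real
  assumes pos: "\<And>i. 1 \<le> i \<Longrightarrow> i \<le> Suc k \<Longrightarrow> a i \<ge> 1" and "0 \<le> t"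
    and x: "x * (rcf_den a (Suc (Suc k)) + t * rcf_den a (Suc k))
      = rcf_num a (Suc (Suc k)) + t * rcf_num a (Suc k)"
  defines "v \<equiv> real_of_int (rcf_den a (Suc k)) / rcf_den a (Suc (Suc k))"
  shows "rcf_Theta x a k = v / (1 + t * v)" and "rcf_Theta x a (Suc k) = t / (1 + t * v)"
proof -
  define p q p' q' :: real where "p = rcf_num a (Suc k)" and "q = rcf_den a (Suc k)"
    and "p' = rcf_num a (Suc (Suc k))" and "q' = rcf_den a (Suc (Suc k))"
  have q: "0 < q" "0 < q'"
    unfolding q_def q'_def of_int_0_less_iff using pos by (intro rcf_den_pos; simp)+
  have "\<bar>p * q' - p' * q\<bar> = real_of_int \<bar>rcf_num a (Suc k) * rcf_den a (Suc (Suc k))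
      - rcf_num a (Suc (Suc k)) * rcf_den a (Suc k)\<bar>"
    unfolding p_def q_def p'_def q'_def by simp
  then have det: "\<bar>p * q' - p' * q\<bar> = 1"
    unfolding rcf_det_abs by simp
  have D: "0 < q' + t * q" using q \<open>0 \<le> t\<close> by (simp add: add_pos_nonneg)
  have x': "x * (q' + t * q) = p' + t * p"
    using x by (simp add: p_def q_def p'_def q'_def)
  \<comment> \<open>Eliminating \<open>x\<close> by means of \<open>x'\<close> leaves only the
    determinant, here and for \<open>x * q' - p'\<close> below.\<close>
  have "(x * q - p) * (q' + t * q) = - (p * q' - p' * q)"
    using x' by algebra
  then have "\<bar>x * q - p\<bar> * (q' + t * q) = 1"
    using D det by (metis abs_minus_cancel abs_mult abs_of_pos)
  then have e1: "\<bar>x * q - p\<bar> = 1 / (q' + t * q)" using D by (simp add: field_simps)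
  have "(x * q' - p') * (q' + t * q) = t * (p * q' - p' * q)"
    using x' by algebra
  then have "\<bar>x * q' - p'\<bar> * (q' + t * q) = t"
    using D det \<open>0 \<le> t\<close> by (metis abs_mult abs_of_pos abs_of_nonneg mult.right_neutral)
  then have e2: "\<bar>x * q' - p'\<bar> = t / (q' + t * q)" using D by (simp add: field_simps)
  have v: "v = q / q'" by (simp add: v_def q_def q'_def)
  have vD: "1 + t * v = (q' + t * q) / q'" using q by (simp add: v field_simps)
  have "rcf_Theta x a k = q * \<bar>x * q - p\<bar>"
    using pos by (subst rcf_Theta_eq) (auto simp: q_def p_def)
  then show "rcf_Theta x a k = v / (1 + t * v)"
    unfolding e1 vD using q D by (simp add: v)
  have "rcf_Theta x a (Suc k) = q' * \<bar>x * q' - p'\<bar>"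
    using pos by (subst rcf_Theta_eq) (auto simp: q'_def p'_def)
  then show "rcf_Theta x a (Suc k) = t / (1 + t * v)"
    unfolding e2 vD using q D by simp
qed

section \<open>Ratios of consecutive denominators\<close>

text \<open>This is the recurrence divided by \<open>q_k\<close>. Iterated, it gives the reversed
  expansion \<open>[0; a_(k+1), ..., a_1]\<close>.\<close>

lemma rcf_den_ratio_Suc:
  assumes "\<And>i. 1 \<le> i \<Longrightarrow> i \<le> k \<Longrightarrow> a i \<ge> 1"
  shows "real_of_int (rcf_den a (Suc k)) / rcf_den a (Suc (Suc k))
    = 1 / (real (a (Suc k)) + real_of_int (rcf_den a k) / rcf_den a (Suc k))"
  proof -
  have "0 < rcf_den a (Suc k)" using assms by (rule rcf_den_pos)
  then show ?thesis by (simp add: field_simps)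
qed

text \<open>Here \<open>w = q_(k-1) / q_k = [0; a_k, ..., a_1]\<close>. It reaches 0 only as the
  empty expansion (\<open>rcf_den a 0 = 0\<close>) and 1 only as \<open>[0; 1]\<close>; these cases
  lead to the extremal expansions.\<close>

lemma rcf_den_ratio_bounds:
  assumes "\<And>i. 1 \<le> i \<Longrightarrow> i \<le> k \<Longrightarrow> a i \<ge> 1"
  defines "w \<equiv> real_of_int (rcf_den a k) / rcf_den a (Suc k)"
  shows "0 \<le> w" and "w \<le> 1" and "w = 0 \<Longrightarrow> k = 0" and "w = 1 \<Longrightarrow> k = 1 \<and> a 1 = 1"
proof -
  show "0 \<le> w" by (simp add: w_def rcf_den_nonneg)
  have "w \<le> 1 \<and> (w = 0 \<longrightarrow> k = 0) \<and> (w = 1 \<longrightarrow> k = 1 \<and> a 1 = 1)"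
  proof (cases k)
    case 0
    then show ?thesis by (simp add: w_def)
  next
    case (Suc j)
    have pos: "\<And>i. 1 \<le> i \<Longrightarrow> i \<le> j \<Longrightarrow> a i \<ge> 1" and a: "a (Suc j) \<ge> 1"
      using assms(1) Suc by auto
    define w' where "w' = rcf_den a j / rcf_den a (Suc j)"
    have w: "w = 1 / (real (a (Suc j)) + w')"
      unfolding w_def Suc w'_def by (rule rcf_den_ratio_Suc[OF pos])
    have w': "0 \<le> w'" by (simp add: w'_def rcf_den_nonneg)
    have j: "j = 0" if "w' = 0"
    proof (rule ccontr)
      assume "j \<noteq> 0"
      then obtain i where i: "j = Suc i" using not0_implies_Suc by blast
      then have "0 < rcf_den a j" using pos by (intro rcf_den_pos[of i a, folded i]) auto
      moreover have "0 < rcf_den a (Suc j)" using pos by (rule rcf_den_pos)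
      ultimately have "w' > 0" by (simp add: w'_def)
      then show False using that by simp
    qed
    have "w \<le> 1" using w a w' by simp
    moreover have "w \<noteq> 0" using w a w' by simp
    moreover have "k = 1 \<and> a 1 = 1" if "w = 1"
    proof -
      have "real (a (Suc j)) + w' = 1" using w that by (simp split: if_splits)
      then have "w' = 0" "a (Suc j) = 1" using a w' by simp_all
      then show ?thesis using j Suc by simp
    qed
    ultimately show ?thesis by simp
  qed
  then show "w \<le> 1" and "w = 0 \<Longrightarrow> k = 0" and "w = 1 \<Longrightarrow> k = 1 \<and> a 1 = 1" by auto
qed

subsection \<open>Bounds for \<open>A / (A B + 1)\<close> and \<open>B / (A B + 1)\<close>\<close>

text \<open>Written as \<open>1 / (B + 1 / A)\<close>, the fraction visibly increases in
  \<open>A\<close> and decreases in \<open>B\<close>.\<close>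

lemma frac_mono:
  fixes A B A' B' :: real
  assumes "0 < A" "A \<le> A'" "0 < B'" "B' \<le> B"
  shows "A / (A * B + 1) \<le> A' / (A' * B' + 1)"
    and "A \<noteq> A' \<or> B \<noteq> B' \<Longrightarrow> A / (A * B + 1) < A' / (A' * B' + 1)"
proof -
  have e: "A / (A * B + 1) = 1 / (B + 1 / A)" "A' / (A' * B' + 1) = 1 / (B' + 1 / A')"
    using assms by (simp_all add: field_simps)
  have i: "1 / A' \<le> 1 / A" using assms by (simp add: frac_le)
  have p: "0 < B' + 1 / A'" using assms by (simp add: add_pos_pos)
  show "A / (A * B + 1) \<le> A' / (A' * B' + 1)"
    unfolding e using i p assms by (intro frac_le) auto
  assume "A \<noteq> A' \<or> B \<noteq> B'"
  moreover have "1 / A' < 1 / A" if "A \<noteq> A'" using that assms by (simp add: frac_less2)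
  ultimately have "B' + 1 / A' < B + 1 / A" using i assms by fastforce
  then show "A / (A * B + 1) < A' / (A' * B' + 1)"
    unfolding e using p by (intro divide_strict_left_mono) auto
qed

text \<open>After cross-multiplication the difference factors as
  \<open>(B - A) * (A * B - 1)\<close>.\<close>

lemma div_square_add_one_antimono:
  fixes A B :: real
  assumes "1 \<le> A" "A \<le> B"
  shows "B / (B\<^sup>2 + 1) \<le> A / (A\<^sup>2 + 1)"
proof -
  have "0 \<le> (B - A) * (A * B - 1)"
    using assms mult_mono[of 1 A 1 B] by (intro mult_nonneg_nonneg) auto
  then have "B * (A\<^sup>2 + 1) \<le> A * (B\<^sup>2 + 1)" by (simp add: algebra_simps power2_eq_square)
  moreover have "0 < A\<^sup>2 + 1" "0 < B\<^sup>2 + 1" by (simp_all add: add_nonneg_pos)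
  ultimately show ?thesis by (simp add: divide_le_eq le_divide_eq mult.commute)
qed

text \<open>Both variables range over the same interval \<open>[L, U]\<close>, and each fraction is
  compared with its value on the diagonal \<open>A = B\<close>, where it becomes
  \<open>z / (z\<^sup>2 + 1)\<close>. The lower bound for the maximum is attained only at
  \<open>u = w = 0\<close>; the upper bound for the minimum is attained at \<open>u = w = 1\<close>,
  hence is not strict.\<close>

lemma frac_equal_digits:
  fixes m u w :: real
  assumes m: "1 \<le> m" and u: "0 \<le> u" "u \<le> 1" and w: "0 \<le> w" "w \<le> 1"
  defines "A \<equiv> 1 + 1 / (m + u)" and "B \<equiv> 1 + 1 / (m + w)"
  shows "min (A / (A * B + 1)) (B / (A * B + 1)) \<le> (m + 1) * (m + 2) / ((m + 1)\<^sup>2 + (m + 2)\<^sup>2)"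
    and "u \<noteq> 0 \<or> w \<noteq> 0 \<Longrightarrow>
      m * (m + 1) / (m\<^sup>2 + (m + 1)\<^sup>2) < max (A / (A * B + 1)) (B / (A * B + 1))"
proof -
  define L U where "L = 1 + 1 / (m + 1)" and "U = 1 + 1 / m"
  have L: "1 \<le> L" "L \<le> A" "L \<le> B"
    using m u w by (auto simp: L_def A_def B_def intro!: frac_le)
  have U: "A \<le> U" "B \<le> U"
    using m u w by (auto simp: U_def A_def B_def intro!: frac_le)
  have UAB: "A \<noteq> U \<or> B \<noteq> U" if "u \<noteq> 0 \<or> w \<noteq> 0"
    using that m u w by (auto simp: U_def A_def B_def)
  have Le: "L / (L\<^sup>2 + 1) = (m + 1) * (m + 2) / ((m + 1)\<^sup>2 + (m + 2)\<^sup>2)"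
  proof -
    have L': "L = (m + 2) / (m + 1)" using m by (simp add: L_def field_simps)
    have "L\<^sup>2 + 1 = ((m + 1)\<^sup>2 + (m + 2)\<^sup>2) / (m + 1)\<^sup>2"
      unfolding L' power_divide using m by (simp add: add_divide_distrib)
    then show ?thesis using m by (simp add: L' power2_eq_square)
  qed
  have Ue: "U / (U\<^sup>2 + 1) = m * (m + 1) / (m\<^sup>2 + (m + 1)\<^sup>2)"
  proof -
    have U': "U = (m + 1) / m" using m by (simp add: U_def field_simps)
    have "U\<^sup>2 + 1 = (m\<^sup>2 + (m + 1)\<^sup>2) / m\<^sup>2"
      unfolding U' power_divide using m by (simp add: add_divide_distrib)
    then show ?thesis using m by (simp add: U' power2_eq_square)
  qed
  have lower: "min (C / (C * D + 1)) (D / (C * D + 1)) \<le> L / (L\<^sup>2 + 1)"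
    if "L \<le> C" "C \<le> D" for C D
  proof -
    have "C / (C * D + 1) \<le> C / (C * C + 1)" using that L by (intro frac_mono) auto
    also have "\<dots> \<le> L / (L\<^sup>2 + 1)"
      using div_square_add_one_antimono[of L C] that L by (simp add: power2_eq_square)
    finally show ?thesis by simp
  qed
  have upper: "U / (U\<^sup>2 + 1) < max (C / (C * D + 1)) (D / (C * D + 1))"
    if "L \<le> C" "C \<le> D" "D \<le> U" "C \<noteq> U \<or> D \<noteq> U" for C D
  proof -
    have "C \<noteq> U" using that by auto
    have diag: "U / (U\<^sup>2 + 1) \<le> D / (D\<^sup>2 + 1)"
      using that L by (intro div_square_add_one_antimono) auto
    have "U / (U\<^sup>2 + 1) < D / (D * C + 1)"
    \<comment> \<open>Off the diagonal, the comparison with the diagonal is strict; on it,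
      \<open>D < U\<close> and the decrease of \<open>z / (z\<^sup>2 + 1)\<close> is strict.\<close>
    proof (cases "C = D")
      case False
      have "D / (D * D + 1) < D / (D * C + 1)"
        by (rule frac_mono(2)) (use that L False in auto)
      then show ?thesis
        using diag by (simp add: power2_eq_square)
    next
      case True
      then have "D < U" using that \<open>C \<noteq> U\<close> by auto
      have "1 < D * U" using that L \<open>D < U\<close> by (intro less_le_trans[OF _ mult_right_mono[of 1 D U]]) auto
      then have "0 < (U - D) * (D * U - 1)" using \<open>D < U\<close> by simp
      then have "U * (D * D + 1) < D * (U\<^sup>2 + 1)"
        by (simp add: algebra_simps power2_eq_square)
      moreover have "0 < D * D + 1" "0 < U\<^sup>2 + 1" by (simp_all add: add_nonneg_pos)
      ultimately show ?thesis using True by (simp add: divide_less_eq less_divide_eq mult.commute)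
    qed
    then show ?thesis by (simp add: mult.commute)
  qed
  show "min (A / (A * B + 1)) (B / (A * B + 1)) \<le> (m + 1) * (m + 2) / ((m + 1)\<^sup>2 + (m + 2)\<^sup>2)"
    using lower[of A B] lower[of B A] L by (fold Le) (metis linear min.commute mult.commute)
  assume "u \<noteq> 0 \<or> w \<noteq> 0"
  then show "m * (m + 1) / (m\<^sup>2 + (m + 1)\<^sup>2) < max (A / (A * B + 1)) (B / (A * B + 1))"
    using upper[of A B] upper[of B A] L U UAB
    by (fold Ue) (metis linear max.commute mult.commute)
qed

text \<open>A single corner, \<open>u = 0\<close> and \<open>w = 1\<close>, maximises the first
  fraction and minimises the second; \<open>ne\<close> excludes it, so both bounds are
  strict.\<close>

lemma frac_distinct_digits:
  fixes m M u w :: real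
  assumes m: "1 \<le> m" and M: "m + 1 \<le> M" and u: "0 \<le> u" "u \<le> 1" and w: "0 \<le> w" "w \<le> 1"
    and ne: "u \<noteq> 0 \<or> w \<noteq> 1"
  defines "A \<equiv> 1 + 1 / (M + u)" and "B \<equiv> 1 + 1 / (m + w)"
  shows "A / (A * B + 1) < (m + 1) * (M + 1) / ((m + 1) * M + (m + 2) * (M + 1))"
    and "(m + 2) * M / ((m + 1) * M + (m + 2) * (M + 1)) < B / (A * B + 1)"
proof -
  \<comment> \<open>The values of \<open>A\<close> and \<open>B\<close> at that corner.\<close>
  define A' B' where "A' = (M + 1) / M" and "B' = (m + 2) / (m + 1)"
  have A'': "A' = 1 + 1 / M" and B'': "B' = 1 + 1 / (m + 1)"
    using m M by (simp_all add: A'_def B'_def field_simps)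
  have A: "0 < A" "A \<le> A'" unfolding A'' A_def using m M u
    by (auto intro!: frac_le add_pos_nonneg)
  have B: "0 < B'" "B' \<le> B" unfolding B'' B_def using m M w
    by (auto intro!: frac_le add_pos_nonneg)
  have n: "A \<noteq> A' \<or> B \<noteq> B'"
    using ne m M u w by (auto simp: A'' B'' A_def B_def)
  have d: "A' * B' + 1 = ((m + 1) * M + (m + 2) * (M + 1)) / ((m + 1) * M)"
      proof -
    have "A' * B' = (m + 2) * (M + 1) / ((m + 1) * M)"
      by (simp add: A'_def B'_def mult.commute)
    then show ?thesis using m M by (simp add: add_divide_distrib)
  qed
  have "A' / (A' * B' + 1) = (m + 1) * (M + 1) / ((m + 1) * M + (m + 2) * (M + 1))"
    unfolding d using m M by (simp add: A'_def mult.commute)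
  then show "A / (A * B + 1) < (m + 1) * (M + 1) / ((m + 1) * M + (m + 2) * (M + 1))"
    using frac_mono(2)[OF A B n] by simp
  have "B' / (B' * A' + 1) = (m + 2) * M / ((m + 1) * M + (m + 2) * (M + 1))"
    unfolding mult.commute[of B'] d using m M by (simp add: B'_def mult.commute)
  then show "(m + 2) * M / ((m + 1) * M + (m + 2) * (M + 1)) < B / (A * B + 1)"
    using frac_mono(2)[OF B A] n by (auto simp: mult.commute)
qed

section \<open>The numerical bounds 1/2 and 2/5\<close>

text \<open>The sum of the squares exceeds twice the product by
  \<open>((m + 2) - (m + 1))\<^sup>2 = 1\<close>.\<close>

lemma consecutive_product_less_half:
  fixes m :: real
  assumes "0 \<le> m"
  shows "(m + 1) * (m + 2) / ((m + 1)\<^sup>2 + (m + 2)\<^sup>2) < 1 / 2"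
proof -
  have "2 * ((m + 1) * (m + 2)) < (m + 1)\<^sup>2 + (m + 2)\<^sup>2"
    by (simp add: power2_eq_square algebra_simps)
  moreover have "0 < (m + 1)\<^sup>2 + (m + 2)\<^sup>2" using assms by (simp add: add_pos_pos)
  ultimately show ?thesis by (simp add: divide_less_eq)
qed

lemma consecutive_product_ge_two_fifths:
  fixes m :: real
  assumes "1 \<le> m"
  shows "2 / 5 \<le> m * (m + 1) / (m\<^sup>2 + (m + 1)\<^sup>2)"
proof -
  have "0 \<le> (m - 1) * (m + 2)" using assms by simp
  then have "2 * (m\<^sup>2 + (m + 1)\<^sup>2) \<le> 5 * (m * (m + 1))"
    by (simp add: power2_eq_square algebra_simps)
  moreover have "0 < m\<^sup>2 + (m + 1)\<^sup>2" using assms by (simp add: add_pos_pos)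
  ultimately show ?thesis by (simp add: le_divide_eq)
qed

subsection \<open>Two consecutive partial quotients equal to 1\<close>

text \<open>Here \<open>u = [0; a_(n+3), ...]\<close> and \<open>w = [0; a_(n-2), ..., a_1]\<close>.
  The clauses for the values 0 and 1 record which expansions reach the corners.\<close>

lemma rcf_Theta_one_one:
  assumes exp: "rcf_expansion x a N" and n: "n \<ge> 2" and N: "enat (n + 2) \<le> N"
    and one: "a n = 1" "a (n + 1) = 1"
  obtains u w :: real where
    "0 \<le> u" "u \<le> 1" "0 \<le> w" "w \<le> 1"
    "u = 0 \<Longrightarrow> N = enat (n + 2)" "u = 1 \<Longrightarrow> N = enat (n + 3) \<and> a (n + 3) = 1"
    "w = 0 \<Longrightarrow> n = 2" "w = 1 \<Longrightarrow> n = 3 \<and> a 1 = 1"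
    "\<And>A B. A = 1 + 1 / (real (a (n + 2)) + u) \<Longrightarrow> B = 1 + 1 / (real (a (n - 1)) + w) \<Longrightarrow>
      rcf_Theta x a (n - 1) = A / (A * B + 1) \<and> rcf_Theta x a n = B / (A * B + 1)"
proof -
  have pos: "a i \<ge> 1" if "1 \<le> i" "i \<le> n + 2" for i
    using rcf_expansion_digit_pos[OF exp that(1)] that(2) N
    by (meson enat_ord_simps(1) order_trans)
  obtain N' where N': "N = enat (n + 2) + N'" using N by (metis le_iff_add)
  \<comment> \<open>This form lets \<open>a (n + 1)\<close> and \<open>a (n + 2)\<close> be split
    off the tail after \<open>n\<close> digits.\<close>
  have "N = enat n + eSuc (eSuc N')"
    unfolding N' by (cases N') (simp_all add: eSuc_enat)
  with exp have "rcf_expansion x a (enat n + eSuc (eSuc N'))" by simp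
  then obtain t :: real where t: "rcf_expansion t (\<lambda>i. a (i + n)) (eSuc (eSuc N'))"
    "x * (rcf_den a (Suc n) + t * rcf_den a n) = rcf_num a (Suc n) + t * rcf_num a n"
    by (rule rcf_expansion_tail)
  from t(1) obtain s where s: "rcf_expansion s (\<lambda>i. a (Suc i + n)) (eSuc N')"
    "t = 1 / (real (a (1 + n)) + s)" by (rule rcf_expansion_eSucE)
  from s(1) obtain u where u: "rcf_expansion u (\<lambda>i. a (Suc (Suc i) + n)) N'"
    "s = 1 / (real (a (Suc 1 + n)) + u)" by (rule rcf_expansion_eSucE)
  obtain k where k: "n = Suc (Suc k)" using n by (metis add_2_eq_Suc le_Suc_ex)
  \<comment> \<open>By the index shift and \<open>n = k + 2\<close>, this is
    \<open>q_(n-3) / q_(n-2)\<close>, which is 0 when \<open>n = 2\<close>.\<close>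
  define w where "w = real_of_int (rcf_den a k) / rcf_den a (Suc k)"
  have posk: "\<And>i. 1 \<le> i \<Longrightarrow> i \<le> k \<Longrightarrow> a i \<ge> 1" using pos k by simp
  note w = rcf_den_ratio_bounds[of k a, OF posk, folded w_def]
  define v where "v = rcf_den a n / rcf_den a (Suc n)"
  have v: "v = 1 / (1 + 1 / (real (a (n - 1)) + w))"
  proof -
    have "v = 1 / (real (a n) + rcf_den a (Suc k) / rcf_den a (Suc (Suc k)))"
      unfolding v_def k by (rule rcf_den_ratio_Suc) (use pos k in auto)
    also have "rcf_den a (Suc k) / rcf_den a (Suc (Suc k)) = 1 / (real (a (Suc k)) + w)"
      unfolding w_def by (rule rcf_den_ratio_Suc) (use posk in auto)
    finally show ?thesis using k one by simp
  qed
  have tT: "t = 1 / (1 + 1 / (real (a (n + 2)) + u))"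
    using s(2) u(2) one by (simp add: add.commute)
  have t0: "0 \<le> t" using rcf_expansion_bounds[OF t(1)] by simp
  have posn: "\<And>i. 1 \<le> i \<Longrightarrow> i \<le> Suc (Suc k) \<Longrightarrow> a i \<ge> 1" using pos k by simp
  have Th: "rcf_Theta x a (n - 1) = v / (1 + t * v)" "rcf_Theta x a n = t / (1 + t * v)"
    using rcf_Theta_pair[OF posn t0 t(2)[unfolded k]] by (simp_all add: v_def k)
  show thesis
  proof
    show "0 \<le> u" "u \<le> 1" using rcf_expansion_bounds[OF u(1)] by auto
    show "N = enat (n + 2)" if "u = 0"
      using rcf_expansion_eq_0 u(1) that N' by auto
    show "N = enat (n + 3) \<and> a (n + 3) = 1" if "u = 1"
      using rcf_expansion_eq_1[OF u(1)[unfolded that]] N'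
      by (simp add: one_enat_def numeral_3_eq_3)
    show "0 \<le> w" "w \<le> 1" using w posk by auto
    show "n = 2" if "w = 0" using w(3) posk that k by simp
    show "n = 3 \<and> a 1 = 1" if "w = 1" using w(4) posk that k by simp
    fix A B assume AB: "A = 1 + 1 / (real (a (n + 2)) + u)" "B = 1 + 1 / (real (a (n - 1)) + w)"
    have "0 < A" "0 < B"
      unfolding AB using \<open>0 \<le> u\<close> \<open>0 \<le> w\<close> by (simp_all add: add_pos_nonneg)
    have tv: "t = 1 / A" "v = 1 / B" using AB tT v by simp_all
    have "1 + t * v = (A * B + 1) / (A * B)"
      using \<open>0 < A\<close> \<open>0 < B\<close> by (simp add: tv add_divide_distrib)
    with \<open>0 < A\<close> \<open>0 < B\<close> show "rcf_Theta x a (n - 1) = A / (A * B + 1) \<and> rcf_Theta x a n = B / (A * B + 1)"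
      unfolding Th by (simp add: tv)
  qed
qed

theorem theorem3p2:
  fixes x :: real and a :: "nat \<Rightarrow> nat" and N :: enat and n m M :: nat
  assumes "0 \<le> x" and "x < 1"
    and "rcf_expansion x a N"
    and "n \<ge> 2" and "enat (n + 2) \<le> N"
    and "a n = 1" and "a (n + 1) = 1"
    and "m = min (a (n - 1)) (a (n + 2))"
    and "M = max (a (n - 1)) (a (n + 2))"
  shows "(1 \<le> m \<and> m = M \<longrightarrow>
            min (rcf_Theta x a (n - 1)) (rcf_Theta x a n)
              \<le> (real m + 1) * (real m + 2) / ((real m + 1)\<^sup>2 + (real m + 2)\<^sup>2) \<and>
            (real m + 1) * (real m + 2) / ((real m + 1)\<^sup>2 + (real m + 2)\<^sup>2) < 1 / 2 \<and>
            (\<not> extremal_expansion a N n \<longrightarrow>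
               max (rcf_Theta x a (n - 1)) (rcf_Theta x a n)
                 > real m * (real m + 1) / ((real m)\<^sup>2 + (real m + 1)\<^sup>2)) \<and>
            real m * (real m + 1) / ((real m)\<^sup>2 + (real m + 1)\<^sup>2) \<ge> 2 / 5) \<and>
         (1 \<le> m \<and> m < M \<and> \<not> extremal_expansion a N n \<longrightarrow>
            min (rcf_Theta x a (n - 1)) (rcf_Theta x a n)
              < (real m + 1) * (real M + 1)
                  / ((real m + 1) * real M + (real m + 2) * (real M + 1)) \<and>
            max (rcf_Theta x a (n - 1)) (rcf_Theta x a n)
              > (real m + 2) * real M
                  / ((real m + 1) * real M + (real m + 2) * (real M + 1)))"
proof -
  obtain u w :: real where u: "0 \<le> u" "u \<le> 1" and w: "0 \<le> w" "w \<le> 1"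
    and ends: "u = 0 \<Longrightarrow> N = enat (n + 2)" "u = 1 \<Longrightarrow> N = enat (n + 3) \<and> a (n + 3) = 1"
      "w = 0 \<Longrightarrow> n = 2" "w = 1 \<Longrightarrow> n = 3 \<and> a 1 = 1"
    and Th: "\<And>A B. A = 1 + 1 / (real (a (n + 2)) + u) \<Longrightarrow> B = 1 + 1 / (real (a (n - 1)) + w) \<Longrightarrow>
      rcf_Theta x a (n - 1) = A / (A * B + 1) \<and> rcf_Theta x a n = B / (A * B + 1)"
    by (rule rcf_Theta_one_one[OF assms(3-7)]) blast
  define A B where "A = 1 + 1 / (real (a (n + 2)) + u)" and "B = 1 + 1 / (real (a (n - 1)) + w)"
  have T: "rcf_Theta x a (n - 1) = A / (A * B + 1)" "rcf_Theta x a n = B / (A * B + 1)"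
    using Th[OF A_def B_def] by auto
  show ?thesis
  proof (intro conjI impI; (elim conjE)?)
    assume m: "1 \<le> m" "m = M"
    then have eq: "a (n + 2) = m" "a (n - 1) = m" using assms(8,9) by linarith+
    show "min (rcf_Theta x a (n - 1)) (rcf_Theta x a n)
        \<le> (real m + 1) * (real m + 2) / ((real m + 1)\<^sup>2 + (real m + 2)\<^sup>2)"
      unfolding T A_def B_def eq using m u w by (intro frac_equal_digits(1)) auto
    show "(real m + 1) * (real m + 2) / ((real m + 1)\<^sup>2 + (real m + 2)\<^sup>2) < 1 / 2"
      by (rule consecutive_product_less_half) simp
    show "real m * (real m + 1) / ((real m)\<^sup>2 + (real m + 1)\<^sup>2) \<ge> 2 / 5"
      using m by (intro consecutive_product_ge_two_fifths) simp
    assume "\<not> extremal_expansion a N n"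
    \<comment> \<open>Otherwise \<open>n = 2\<close>, \<open>N = 4\<close> and
      \<open>a 1 = a 4\<close>, the first extremal family.\<close>
    then have "u \<noteq> 0 \<or> w \<noteq> 0" using ends eq by (auto simp: extremal_expansion_def)
    then show "max (rcf_Theta x a (n - 1)) (rcf_Theta x a n)
        > real m * (real m + 1) / ((real m)\<^sup>2 + (real m + 1)\<^sup>2)"
      unfolding T A_def B_def eq using m u w by (intro frac_equal_digits(2)) auto
  next
    let ?lo = "(real m + 1) * (real M + 1) / ((real m + 1) * real M + (real m + 2) * (real M + 1))"
    let ?hi = "(real m + 2) * real M / ((real m + 1) * real M + (real m + 2) * (real M + 1))"
    assume m: "1 \<le> m" "m < M" and ext: "\<not> extremal_expansion a N n"
    \<comment> \<open>The position of the larger digit decides which coefficient is the small one;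
      the second alternative exchanges \<open>A\<close> and \<open>B\<close>.\<close>
    have "(A / (A * B + 1) < ?lo \<and> ?hi < B / (A * B + 1)) \<or>
        (B / (B * A + 1) < ?lo \<and> ?hi < A / (B * A + 1))"
    proof (cases "a (n - 1) < a (n + 2)")
      case True
      then have eq: "a (n + 2) = M" "a (n - 1) = m" using assms(8,9) by auto
      \<comment> \<open>The excluded corner would be \<open>[0; 1, m, 1, 1, M]\<close> with
        \<open>n = 3\<close>.\<close>
      have "u \<noteq> 0 \<or> w \<noteq> 1" using ends eq m ext
        by (auto simp: extremal_expansion_def)
      then show ?thesis
        unfolding A_def B_def eq using m u w
        by - (rule disjI1, intro conjI frac_distinct_digits, auto)
    next
      case False
      then have eq: "a (n + 2) = m" "a (n - 1) = M" using assms(8,9) by auto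
      \<comment> \<open>The excluded corner would be \<open>[0; M, 1, 1, m, 1]\<close> with
        \<open>n = 2\<close>.\<close>
      have "w \<noteq> 0 \<or> u \<noteq> 1" using ends eq m ext
        by (auto simp: extremal_expansion_def)
      then show ?thesis
        unfolding A_def B_def eq using m u w
        by - (rule disjI2, intro conjI frac_distinct_digits, auto)
    qed
    then have "min (rcf_Theta x a (n - 1)) (rcf_Theta x a n) < ?lo \<and>
        ?hi < max (rcf_Theta x a (n - 1)) (rcf_Theta x a n)"
      unfolding T by (auto simp: mult.commute[of B A])
    then show "min (rcf_Theta x a (n - 1)) (rcf_Theta x a n) < ?lo"
      and "max (rcf_Theta x a (n - 1)) (rcf_Theta x a n) > ?hi" by auto
  qed
qed

end
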